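(* Let $m\ge2$ be an integer, let $\alpha_0,\dots,\alpha_{m-1}$ be nonnegative reals with $\sum_{i=0}^{m-1}\alpha_i=1$, and suppose the Basic Hypothesis (see context) holds. Let $Y$ be a real Banach space, let $(y_0,\dots,y_{m-1})\in Y^m$, and let $(y_n)_{n\in\mathbb N}$ be generated by $$(\forall n\ge m)\quad y_n=\alpha_{m-1}y_{n-1}+\cdots+\alpha_0y_{n-m}.$$ Then $(y_n)_{n\in\mathbb N}$ converges (in norm), and $$\lim_{n\to\infty}y_n=\ell(y_0,\dots,y_{m-1})=\frac{\sum_{k=0}^{m-1}a_ky_k}{\sum_{k=0}^{m-1}a_k}=\frac{\sum_{k=0}^{m-1}\sum_{i=0}^{k}\alpha_iy_k}{\sum_{k=0}^{m-1}\sum_{i=0}^{k}\alpha_i}=\sum_{k=0}^{m-1}\lambda_ky_k .$$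
   Context: For $k\in\{0,\dots,m-1\}$: $a_k=\sum_{i=0}^k\alpha_i$ and $\lambda_k=a_k/\sum_{i=0}^{m-1}a_i$. Basic Hypothesis: the polynomial $p(x)=x^m-\alpha_{m-1}x^{m-1}-\cdots-\alpha_1x-\alpha_0$ has a unique positive root, which is simple and equal to $1$, and every other (complex) root has modulus strictly less than $1$. $\ell(y_0,\dots,y_{m-1})$ denotes, by definition, the limit of the sequence $(y_n)_{n\in\mathbb N}$ in $Y$ generated by the linear recurrence $y_n=\alpha_{m-1}y_{n-1}+\cdots+\alpha_0y_{n-m}$ (for all $n\ge m$) from the initial data $(y_0,\dots,y_{m-1})\in Y^m$, whenever this limit exists. *)

theory Defs
  imports "HOL-Analysis.Analysis" "HOL-Computational_Algebra.Polynomial"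
begin

text \<open>
  Coefficients \<open>\<alpha>\<^sub>0, \<dots>, \<alpha>\<^sub>m\<^sub>-\<^sub>1\<close> and initial data \<open>y\<^sub>0, \<dots>, y\<^sub>m\<^sub>-\<^sub>1\<close> are functions on \<^typ>\<open>nat\<close>
  of which only the values at indices below \<open>m\<close> are used.
\<close>

definition char_poly :: "nat \<Rightarrow> (nat \<Rightarrow> real) \<Rightarrow> real poly" where
  "char_poly m \<alpha> = monom 1 m - (\<Sum>i<m. monom (\<alpha> i) i)"

definition basic_hypothesis :: "nat \<Rightarrow> (nat \<Rightarrow> real) \<Rightarrow> bool" where
  "basic_hypothesis m \<alpha> \<longleftrightarrow>
     {x. 0 < x \<and> poly (char_poly m \<alpha>) x = 0} = {1} \<and>
     order 1 (char_poly m \<alpha>) = 1 \<and>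
     (\<forall>z::complex. poly (map_poly complex_of_real (char_poly m \<alpha>)) z = 0 \<and> z \<noteq> 1 \<longrightarrow> cmod z < 1)"

definition partial_coeff :: "(nat \<Rightarrow> real) \<Rightarrow> nat \<Rightarrow> real" where
  "partial_coeff \<alpha> k = (\<Sum>i\<le>k. \<alpha> i)"

definition weight :: "nat \<Rightarrow> (nat \<Rightarrow> real) \<Rightarrow> nat \<Rightarrow> real" where
  "weight m \<alpha> k = partial_coeff \<alpha> k / (\<Sum>i<m. partial_coeff \<alpha> i)"

definition satisfies_recurrence ::
    "nat \<Rightarrow> (nat \<Rightarrow> real) \<Rightarrow> (nat \<Rightarrow> 'a::real_vector) \<Rightarrow> bool" where
  "satisfies_recurrence m \<alpha> y \<longleftrightarrow> (\<forall>n\<ge>m. y n = (\<Sum>i<m. \<alpha> i *\<^sub>R y (n - m + i)))"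

text \<open>
  The sequence \<open>z\<close> below is determined by \<open>v 0, \<dots>, v (m - 1)\<close>; the value is meaningful only
  when that sequence converges.
\<close>

definition ell :: "nat \<Rightarrow> (nat \<Rightarrow> real) \<Rightarrow> (nat \<Rightarrow> 'a::real_normed_vector) \<Rightarrow> 'a" where
  "ell m \<alpha> v =
     (THE l. \<exists>z. (\<forall>k<m. z k = v k) \<and> satisfies_recurrence m \<alpha> z \<and> z \<longlonglongrightarrow> l)"

end

theory Submission
  imports Defs "HOL-Computational_Algebra.Fundamental_Theorem_Algebra"
begin

text \<open>
  Write \<open>E\<close> for the shift \<open>(E y) n = y (n + 1)\<close>, so that the recurrence reads \<open>p(E) y = 0\<close>. Since
  \<open>\<alpha>\<^sub>0 + \<dots> + \<alpha>\<^sub>m\<^sub>-\<^sub>1 = 1\<close>, summation by parts gives the factorization \<open>p(x) = (x - 1) q(x)\<close> with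
  \<open>q(x) = a\<^sub>0 + a\<^sub>1 x + \<dots> + a\<^sub>m\<^sub>-\<^sub>1 x^(m-1)\<close> (\<open>sum_partial_coeff_diff\<close>). Read as a statement
  about \<open>E\<close>, it says that \<open>q(E) y\<close> is a constant sequence, that is, \<open>\<Sum>k<m. a\<^sub>k y\<^sub>n\<^sub>+\<^sub>k\<close> is a conserved
  quantity (\<open>recurrence_invariant\<close>). If \<open>y\<close> converges to \<open>L\<close>, letting \<open>n\<close> tend to infinity in this
  quantity yields \<open>(\<Sum>k<m. a\<^sub>k) L = (\<Sum>k<m. a\<^sub>k y\<^sub>k)\<close>, which is the formula for the limit.

  For convergence, note that \<open>q(1) = \<Sum>k<m. a\<^sub>k > 0\<close>, so the roots of \<open>q\<close> are roots of \<open>p\<close> other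
  than \<open>1\<close>, and the Basic Hypothesis puts them in the open unit disc. A complex sequence \<open>w\<close> for
  which \<open>q(E) w\<close> converges must then converge itself: strip the linear factors \<open>E - r\<close> of \<open>q(E)\<close>
  one at a time, each of them being stably invertible because \<open>\<bar>r\<bar> < 1\<close>
  (\<open>convergent_of_shift_apply\<close>). Applied to the constant sequence \<open>q(E) y\<close>, this settles scalar
  solutions. A solution in a Banach space is a linear combination of its \<open>m\<close> initial vectors
  whose coefficients are scalar solutions, the same for all initial data
  (\<open>recurrence_eq_sum_fundamental\<close>), so it converges too;
  the complex roots never have to act on the real space.
\<close>

section \<open>Inverting shift polynomials with roots in the open unit disc\<close>

text \<open>
  Iterating \<open>z\<^sub>n\<^sub>+\<^sub>1 = r z\<^sub>n + e\<^sub>n\<close> damps the past geometrically. Once the errors \<open>e\<^sub>n\<close> are below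
  \<open>\<delta> (1 - \<bar>r\<bar>)\<close>, the bound \<open>\<delta>\<close> is stable under the iteration, up to a term \<open>\<bar>r\<bar>^k\<close> that dies out.
\<close>

lemma tendsto_zero_of_first_order:
  fixes z :: "nat \<Rightarrow> complex"
  assumes r: "cmod r < 1" and e: "(\<lambda>n. z (Suc n) - r * z n) \<longlonglongrightarrow> 0"
  shows "z \<longlonglongrightarrow> 0"
proof (rule LIMSEQ_I)
  fix \<epsilon> :: real
  assume "\<epsilon> > 0"
  define \<delta> where "\<delta> = \<epsilon> / 2"
  have \<delta>: "\<delta> > 0" using \<open>\<epsilon> > 0\<close> by (simp add: \<delta>_def)
  have "\<delta> * (1 - cmod r) > 0" using \<delta> r by simp
  from LIMSEQ_D[OF e this] obtain N
    where N: "\<And>n. n \<ge> N \<Longrightarrow> cmod (z (Suc n) - r * z n) < \<delta> * (1 - cmod r)" by auto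
  have bound: "cmod (z (N + k)) \<le> cmod r ^ k * cmod (z N) + \<delta>" for k
  proof (induction k)
    case 0
    show ?case using \<delta> by simp
  next
    case (Suc k)
    have "cmod (z (N + Suc k)) \<le> cmod (r * z (N + k)) + cmod (z (Suc (N + k)) - r * z (N + k))"
      using norm_triangle_ineq[of "r * z (N + k)" "z (Suc (N + k)) - r * z (N + k)"] by simp
    also have "\<dots> \<le> cmod r * (cmod r ^ k * cmod (z N) + \<delta>) + \<delta> * (1 - cmod r)"
      using N[of "N + k"] mult_left_mono[OF Suc, of "cmod r"] by (simp add: norm_mult)
    also have "\<dots> = cmod r ^ Suc k * cmod (z N) + \<delta>"
      by (simp add: algebra_simps)
    finally show ?case .
  qed
  have "(\<lambda>k. cmod r ^ k * cmod (z N)) \<longlonglongrightarrow> 0"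
    using LIMSEQ_power_zero[of "cmod r"] r by (intro tendsto_mult_left_zero) simp
  from LIMSEQ_D[OF this \<delta>] obtain K
    where K: "\<And>k. k \<ge> K \<Longrightarrow> cmod r ^ k * cmod (z N) < \<delta>" by auto
  have "cmod (z n - 0) < \<epsilon>" if "n \<ge> N + K" for n
  proof -
    have "n = N + (n - N)" "n - N \<ge> K" using that by auto
    then show ?thesis using bound[of "n - N"] K[of "n - N"] by (simp add: \<delta>_def)
  qed
  then show "\<exists>M. \<forall>n\<ge>M. cmod (z n - 0) < \<epsilon>" by blast
qed

text \<open>
  Subtracting the fixed point \<open>l / (1 - r)\<close> of \<open>x \<mapsto> r x + l\<close> reduces this to the case of limit \<open>0\<close>.
\<close>

lemma convergent_of_first_order:
  fixes w :: "nat \<Rightarrow> complex"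
  assumes r: "cmod r < 1" and conv: "convergent (\<lambda>n. w (Suc n) - r * w n)"
  shows "convergent w"
proof -
  obtain l where l: "(\<lambda>n. w (Suc n) - r * w n) \<longlonglongrightarrow> l"
    using conv by (auto simp: convergent_def)
  have "r \<noteq> 1" using r by auto
  define c where "c = l / (1 - r)"
  have c: "c - r * c = l"
  proof -
    have "c - r * c = (1 - r) * c" by (simp add: algebra_simps)
    then show ?thesis using \<open>r \<noteq> 1\<close> by (simp add: c_def)
  qed
  have "(\<lambda>n. (w (Suc n) - r * w n) - l) \<longlonglongrightarrow> 0"
    using l by (simp add: LIM_zero)
  also have "(\<lambda>n. (w (Suc n) - r * w n) - l) = (\<lambda>n. (w (Suc n) - c) - r * (w n - c))"
    by (simp add: c[symmetric] algebra_simps)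
  finally have "(\<lambda>n. w n - c) \<longlonglongrightarrow> 0"
    by (rule tendsto_zero_of_first_order[OF r])
  then show ?thesis
    using LIM_zero_cancel convergentI by blast
qed

definition shift_apply :: "complex poly \<Rightarrow> (nat \<Rightarrow> complex) \<Rightarrow> nat \<Rightarrow> complex" where
  "shift_apply q w n = (\<Sum>i\<le>degree q. coeff q i * w (n + i))"

lemma shift_apply_eq_sum:
  assumes "\<And>i. i \<ge> N \<Longrightarrow> coeff q i = 0"
  shows "shift_apply q w n = (\<Sum>i<N. coeff q i * w (n + i))"
  unfolding shift_apply_def
proof (rule sum.mono_neutral_cong)
  show "\<And>i. i \<in> {..<N} - {..degree q} \<Longrightarrow> coeff q i * w (n + i) = 0"
    by (simp add: coeff_eq_0)
qed (use assms in auto)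

lemma shift_apply_linear_mult:
  "shift_apply ([:- r, 1:] * q) w = shift_apply q (\<lambda>n. w (Suc n) - r * w n)"
proof
  fix n
  let ?p = "[:- r, 1:] * q" and ?N = "Suc (degree q)"
  have coeff_p: "coeff ?p i = coeff (pCons 0 q) i - r * coeff q i" for i
    by (simp add: coeff_pCons split: nat.split)
  have "shift_apply ?p w n = (\<Sum>i<Suc ?N. coeff ?p i * w (n + i))"
    by (rule shift_apply_eq_sum) (auto simp: coeff_p coeff_eq_0 coeff_pCons split: nat.split)
  also have "\<dots> = (\<Sum>i<Suc ?N. coeff (pCons 0 q) i * w (n + i))
      - r * (\<Sum>i<Suc ?N. coeff q i * w (n + i))"
    by (simp only: coeff_p left_diff_distrib sum_subtractf sum_distrib_left mult.assoc)
  also have "(\<Sum>i<Suc ?N. coeff (pCons 0 q) i * w (n + i)) = (\<Sum>i<?N. coeff q i * w (n + Suc i))"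
    by (subst sum.lessThan_Suc_shift) simp
  also have "(\<Sum>i<Suc ?N. coeff q i * w (n + i)) = (\<Sum>i<?N. coeff q i * w (n + i))"
    by (simp add: coeff_eq_0)
  also have "(\<Sum>i<?N. coeff q i * w (n + Suc i)) - r * (\<Sum>i<?N. coeff q i * w (n + i))
      = (\<Sum>i<?N. coeff q i * (w (Suc (n + i)) - r * w (n + i)))"
    by (simp only: right_diff_distrib sum_subtractf sum_distrib_left mult.left_commute add_Suc_right)
  also have "\<dots> = shift_apply q (\<lambda>n. w (Suc n) - r * w n) n"
    by (rule shift_apply_eq_sum[symmetric]) (simp add: coeff_eq_0)
  finally show "shift_apply ?p w n = shift_apply q (\<lambda>n. w (Suc n) - r * w n) n" .
qed

text \<open>
  Induction on the degree: a root \<open>r\<close> of \<open>q\<close> splits off a factor \<open>E - r\<close>, the cofactor handles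
  \<open>(E - r) w\<close> by induction, and the first-order case recovers \<open>w\<close>.
\<close>

lemma convergent_of_shift_apply:
  assumes "q \<noteq> 0" and "\<And>z. poly q z = 0 \<Longrightarrow> cmod z < 1"
    and "convergent (shift_apply q w)"
  shows "convergent w"
  using assms
proof (induction "degree q" arbitrary: q w)
  case 0
  then obtain c where q: "q = [:c:]" by (metis degree_eq_zeroE)
  with 0 have "c \<noteq> 0" by simp
  moreover have "shift_apply q w = (\<lambda>n. c * w n)"
    by (simp add: q shift_apply_def fun_eq_iff)
  ultimately show ?case
    using 0 convergent_mult_const_iff[of c w] by simp
next
  case (Suc d)
  have "\<not> constant (poly q)"
    using Suc.hyps(2) by (simp add: constant_degree)
  then obtain r where r: "poly q r = 0"
    using fundamental_theorem_of_algebra by blast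
  then obtain q' where q': "q = [:- r, 1:] * q'"
    by (metis dvdE poly_eq_0_iff_dvd)
  have "q' \<noteq> 0" using Suc.prems(1) q' by auto
  then have "degree q = Suc (degree q')"
    unfolding q' by (subst degree_mult_eq) auto
  then have "d = degree q'" using Suc.hyps(2) by simp
  moreover have "cmod z < 1" if "poly q' z = 0" for z
    using Suc.prems(2)[of z] that by (simp add: q')
  moreover have "convergent (shift_apply q' (\<lambda>n. w (Suc n) - r * w n))"
    using Suc.prems(3) by (simp only: q' shift_apply_linear_mult)
  ultimately have "convergent (\<lambda>n. w (Suc n) - r * w n)"
    using Suc.hyps(1) \<open>q' \<noteq> 0\<close> by blast
  then show ?case
    using convergent_of_first_order Suc.prems(2)[OF r] by blast
qed

section \<open>The partial sums of the coefficients as cofactor and conserved quantity\<close>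

text \<open>
  Summation by parts. For \<open>x k = z^k\<close> this is the factorization of the characteristic polynomial
  by \<open>z - 1\<close>; for \<open>x k = y (n + k)\<close> it is the same factorization for the shift operator.
\<close>

lemma sum_partial_coeff_diff:
  fixes x :: "nat \<Rightarrow> 'b::real_vector"
  shows "(\<Sum>k<m. partial_coeff \<alpha> k *\<^sub>R (x (Suc k) - x k))
    = (\<Sum>i<m. \<alpha> i) *\<^sub>R x m - (\<Sum>i<m. \<alpha> i *\<^sub>R x i)"
proof (induction m)
  case 0
  show ?case by simp
next
  case (Suc m)
  have "partial_coeff \<alpha> m = (\<Sum>i<m. \<alpha> i) + \<alpha> m"
    by (simp add: partial_coeff_def lessThan_Suc_atMost[symmetric])
  with Suc show ?case by (simp add: algebra_simps)
qed

lemma satisfies_recurrenceD: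
  assumes "satisfies_recurrence m \<alpha> y"
  shows "y (n + m) = (\<Sum>i<m. \<alpha> i *\<^sub>R y (n + i))"
  using assms unfolding satisfies_recurrence_def by (metis add_diff_cancel_right' le_add2)

lemma recurrence_invariant:
  fixes y :: "nat \<Rightarrow> 'b::real_vector"
  assumes sum1: "(\<Sum>i<m. \<alpha> i) = 1" and rec: "satisfies_recurrence m \<alpha> y"
  shows "(\<Sum>k<m. partial_coeff \<alpha> k *\<^sub>R y (n + k)) = (\<Sum>k<m. partial_coeff \<alpha> k *\<^sub>R y k)"
proof (induction n)
  case 0
  show ?case by simp
next
  case (Suc n)
  have "(\<Sum>k<m. partial_coeff \<alpha> k *\<^sub>R (y (n + Suc k) - y (n + k))) = 0"
    using sum_partial_coeff_diff[of \<alpha> "\<lambda>k. y (n + k)" m] sum1 satisfies_recurrenceD[OF rec, of n]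
    by simp
  then show ?case
    using Suc by (simp add: scaleR_diff_right sum_subtractf)
qed

text \<open>
  The top partial sum is the sum of all coefficients, hence \<open>1\<close>, and the others are nonnegative.
\<close>

lemma sum_partial_coeff_pos:
  assumes nonneg: "\<And>i. i < m \<Longrightarrow> \<alpha> i \<ge> 0" and sum1: "(\<Sum>i<m. \<alpha> i) = 1"
  shows "(\<Sum>k<m. partial_coeff \<alpha> k) > 0"
proof -
  obtain d where d: "m = Suc d" using sum1 by (cases m) auto
  have "partial_coeff \<alpha> d = 1"
    using sum1 by (simp add: d partial_coeff_def lessThan_Suc_atMost)
  moreover have "partial_coeff \<alpha> k \<ge> 0" if "k < m" for k
    using nonneg that by (auto simp: partial_coeff_def intro!: sum_nonneg)
  ultimately show ?thesis
    by (auto simp: d intro!: add_nonneg_pos sum_nonneg)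
qed

lemma poly_char_poly_complex:
  "poly (map_poly complex_of_real (char_poly m \<alpha>)) z
    = z ^ m - (\<Sum>i<m. complex_of_real (\<alpha> i) * z ^ i)"
proof -
  have "map_poly complex_of_real (char_poly m \<alpha>)
      = monom 1 m - (\<Sum>i<m. monom (complex_of_real (\<alpha> i)) i)"
    by (rule poly_eqI)
      (simp add: char_poly_def coeff_map_poly coeff_sum if_distrib[of complex_of_real] cong: if_cong)
  then show ?thesis
    by (simp add: poly_monom poly_sum)
qed

section \<open>Convergence of the solutions\<close>

lemma convergent_real_recurrence:
  fixes c :: "nat \<Rightarrow> real"
  assumes nonneg: "\<And>i. i < m \<Longrightarrow> \<alpha> i \<ge> 0" and sum1: "(\<Sum>i<m. \<alpha> i) = 1"
    and hyp: "basic_hypothesis m \<alpha>" and rec: "satisfies_recurrence m \<alpha> c"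
  shows "convergent c"
proof -
  define q where "q = (\<Sum>k<m. monom (complex_of_real (partial_coeff \<alpha> k)) k)"
  have coeff_q: "coeff q k = (if k < m then complex_of_real (partial_coeff \<alpha> k) else 0)" for k
    by (simp add: q_def coeff_sum)
  have poly_q: "poly q z = (\<Sum>k<m. complex_of_real (partial_coeff \<alpha> k) * z ^ k)" for z
    by (simp add: q_def poly_sum poly_monom)
  have "poly q 1 = complex_of_real (\<Sum>k<m. partial_coeff \<alpha> k)"
    by (simp add: poly_q)
  then have q1: "poly q 1 \<noteq> 0"
    using sum_partial_coeff_pos[of m \<alpha>, OF nonneg sum1] by (metis less_irrefl of_real_eq_0_iff)
  have factor: "poly (map_poly complex_of_real (char_poly m \<alpha>)) z = (z - 1) * poly q z" for z
    using sum_partial_coeff_diff[of \<alpha> "\<lambda>k. z ^ k" m] sum1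
    by (simp add: poly_char_poly_complex poly_q scaleR_conv_of_real sum_distrib_left algebra_simps)
  have roots: "cmod z < 1" if "poly q z = 0" for z
  proof -
    have "z \<noteq> 1" using q1 that by auto
    then show ?thesis
      using hyp that factor[of z] by (simp add: basic_hypothesis_def)
  qed
  have "shift_apply q (\<lambda>n. complex_of_real (c n)) n
      = complex_of_real (\<Sum>k<m. partial_coeff \<alpha> k *\<^sub>R c (n + k))" for n
    by (subst shift_apply_eq_sum[of m]) (simp_all add: coeff_q)
  then have "shift_apply q (\<lambda>n. complex_of_real (c n))
      = (\<lambda>n. complex_of_real (\<Sum>k<m. partial_coeff \<alpha> k *\<^sub>R c k))"
    by (simp only: recurrence_invariant[OF sum1 rec] fun_eq_iff) simp
  then have "convergent (shift_apply q (\<lambda>n. complex_of_real (c n)))"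
    by (simp only: convergent_const)
  moreover have "q \<noteq> 0" using q1 by auto
  ultimately have "convergent (\<lambda>n. complex_of_real (c n))"
    using convergent_of_shift_apply roots by blast
  then obtain l where "(\<lambda>n. complex_of_real (c n)) \<longlonglongrightarrow> l"
    by (auto simp: convergent_def)
  from tendsto_Re[OF this] show ?thesis
    by (simp add: convergentI)
qed

function fundamental_solution :: "nat \<Rightarrow> (nat \<Rightarrow> real) \<Rightarrow> nat \<Rightarrow> nat \<Rightarrow> real" where
  "fundamental_solution m \<alpha> j n =
    (if n < m then of_bool (n = j) else \<Sum>i<m. \<alpha> i * fundamental_solution m \<alpha> j (n - m + i))"
  by pat_completeness auto
termination by (relation "Wellfounded.measure (\<lambda>(m, \<alpha>, j, n). n)") auto

declare fundamental_solution.simps [simp del]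

lemma satisfies_recurrence_fundamental:
  "satisfies_recurrence m \<alpha> (fundamental_solution m \<alpha> j)"
  unfolding satisfies_recurrence_def by (auto simp: fundamental_solution.simps[of m \<alpha> j])

text \<open>
  The fundamental solutions carry all the dynamics in scalar coefficients, so that convergence of real
  sequences transfers to any real normed space.
\<close>

lemma recurrence_eq_sum_fundamental:
  fixes y :: "nat \<Rightarrow> 'b::real_vector"
  assumes rec: "satisfies_recurrence m \<alpha> y"
  shows "y n = (\<Sum>j<m. fundamental_solution m \<alpha> j n *\<^sub>R y j)"
proof (induction n rule: less_induct)
  case (less n)
  show ?case
  proof (cases "n < m")
    case True
    have "(\<Sum>j<m. fundamental_solution m \<alpha> j n *\<^sub>R y j) = (\<Sum>j<m. if n = j then y j else 0)"
      by (rule sum.cong) (use True in \<open>auto simp: fundamental_solution.simps\<close>)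
    then show ?thesis using True by simp
  next
    case False
    have "y n = (\<Sum>i<m. \<alpha> i *\<^sub>R y (n - m + i))"
      using rec False by (simp add: satisfies_recurrence_def)
    also have "\<dots> = (\<Sum>i<m. \<alpha> i *\<^sub>R (\<Sum>j<m. fundamental_solution m \<alpha> j (n - m + i) *\<^sub>R y j))"
      by (rule sum.cong) (use False in \<open>auto intro!: arg_cong[where f = "scaleR _"] less\<close>)
    also have "\<dots> = (\<Sum>j<m. (\<Sum>i<m. \<alpha> i * fundamental_solution m \<alpha> j (n - m + i)) *\<^sub>R y j)"
      by (simp only: scaleR_sum_right scaleR_sum_left scaleR_scaleR) (rule sum.swap)
    also have "\<dots> = (\<Sum>j<m. fundamental_solution m \<alpha> j n *\<^sub>R y j)"
      using False by (simp add: fundamental_solution.simps[of m \<alpha> _ n])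
    finally show ?thesis .
  qed
qed

lemma convergent_recurrence:
  fixes y :: "nat \<Rightarrow> 'b::real_normed_vector"
  assumes "\<And>i. i < m \<Longrightarrow> \<alpha> i \<ge> 0" and "(\<Sum>i<m. \<alpha> i) = 1"
    and "basic_hypothesis m \<alpha>" and rec: "satisfies_recurrence m \<alpha> y"
  shows "convergent y"
proof -
  have "convergent (fundamental_solution m \<alpha> j)" for j
    using assms(1-3) satisfies_recurrence_fundamental by (rule convergent_real_recurrence)
  then have "(\<lambda>n. \<Sum>j<m. fundamental_solution m \<alpha> j n *\<^sub>R y j)
      \<longlonglongrightarrow> (\<Sum>j<m. lim (fundamental_solution m \<alpha> j) *\<^sub>R y j)"
    by (intro tendsto_sum tendsto_scaleR tendsto_const) (simp add: convergent_LIMSEQ_iff)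
  then show ?thesis
    by (subst (asm) recurrence_eq_sum_fundamental[OF rec, symmetric]) (rule convergentI)
qed

text \<open>The conserved quantity, evaluated at time \<open>0\<close> and in the limit, determines the limit.\<close>

lemma recurrence_limit_eq:
  fixes y :: "nat \<Rightarrow> 'b::real_normed_vector"
  assumes sum1: "(\<Sum>i<m. \<alpha> i) = 1" and rec: "satisfies_recurrence m \<alpha> y"
    and pos: "(\<Sum>k<m. partial_coeff \<alpha> k) \<noteq> 0" and lim: "y \<longlonglongrightarrow> L"
  shows "L = (\<Sum>k<m. partial_coeff \<alpha> k *\<^sub>R y k) /\<^sub>R (\<Sum>k<m. partial_coeff \<alpha> k)"
proof -
  have "(\<lambda>n. \<Sum>k<m. partial_coeff \<alpha> k *\<^sub>R y (n + k)) \<longlonglongrightarrow> (\<Sum>k<m. partial_coeff \<alpha> k *\<^sub>R L)"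
    by (intro tendsto_sum tendsto_scaleR tendsto_const LIMSEQ_ignore_initial_segment lim)
  then have "(\<lambda>n. \<Sum>k<m. partial_coeff \<alpha> k *\<^sub>R y k) \<longlonglongrightarrow> (\<Sum>k<m. partial_coeff \<alpha> k *\<^sub>R L)"
    by (simp only: recurrence_invariant[OF sum1 rec])
  then have "(\<Sum>k<m. partial_coeff \<alpha> k *\<^sub>R y k) = (\<Sum>k<m. partial_coeff \<alpha> k) *\<^sub>R L"
    by (simp only: LIMSEQ_const_iff scaleR_sum_left)
  then show ?thesis using pos by simp
qed

text \<open>
  The description defining the limit functional is unambiguous because a solution is determined by
  its first \<open>m\<close> values.
\<close>

lemma ell_eq:
  fixes y :: "nat \<Rightarrow> 'b::real_normed_vector"
  assumes rec: "satisfies_recurrence m \<alpha> y" and lim: "y \<longlonglongrightarrow> L"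
  shows "ell m \<alpha> y = L"
  unfolding ell_def
proof (rule the_equality)
  show "\<exists>z. (\<forall>k<m. z k = y k) \<and> satisfies_recurrence m \<alpha> z \<and> z \<longlonglongrightarrow> L"
    using rec lim by blast
next
  fix l
  assume "\<exists>z. (\<forall>k<m. z k = y k) \<and> satisfies_recurrence m \<alpha> z \<and> z \<longlonglongrightarrow> l"
  then obtain z where init: "\<forall>k<m. z k = y k" and z: "satisfies_recurrence m \<alpha> z" "z \<longlonglongrightarrow> l"
    by blast
  have "z n = y n" for n
    unfolding recurrence_eq_sum_fundamental[OF rec, of n] recurrence_eq_sum_fundamental[OF z(1), of n]
    by (rule sum.cong) (use init in auto)
  then have "z = y" by blast
  then show "l = L" using z(2) lim LIMSEQ_unique by blast
qed

theorem corollary2p11: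
  fixes m :: nat and \<alpha> :: "nat \<Rightarrow> real" and y :: "nat \<Rightarrow> 'a::banach"
  assumes "m \<ge> 2"
    and "\<And>i. i < m \<Longrightarrow> \<alpha> i \<ge> 0"
    and "(\<Sum>i<m. \<alpha> i) = 1"
    and "basic_hypothesis m \<alpha>"
    and "satisfies_recurrence m \<alpha> y"
  shows "convergent y
    \<and> lim y = ell m \<alpha> y
    \<and> ell m \<alpha> y =
        (\<Sum>k<m. partial_coeff \<alpha> k *\<^sub>R y k) /\<^sub>R (\<Sum>k<m. partial_coeff \<alpha> k)
    \<and> (\<Sum>k<m. partial_coeff \<alpha> k *\<^sub>R y k) /\<^sub>R (\<Sum>k<m. partial_coeff \<alpha> k) =
        (\<Sum>k<m. \<Sum>i\<le>k. \<alpha> i *\<^sub>R y k) /\<^sub>R (\<Sum>k<m. \<Sum>i\<le>k. \<alpha> i)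
    \<and> (\<Sum>k<m. \<Sum>i\<le>k. \<alpha> i *\<^sub>R y k) /\<^sub>R (\<Sum>k<m. \<Sum>i\<le>k. \<alpha> i) =
        (\<Sum>k<m. weight m \<alpha> k *\<^sub>R y k)"
proof -
  let ?S = "\<Sum>k<m. partial_coeff \<alpha> k"
  have conv: "convergent y"
    using assms(2-5) by (rule convergent_recurrence)
  then have lim: "y \<longlonglongrightarrow> lim y"
    by (simp add: convergent_LIMSEQ_iff)
  have ell: "ell m \<alpha> y = lim y"
    using assms(5) lim by (rule ell_eq)
  have "?S \<noteq> 0"
    using sum_partial_coeff_pos[of m \<alpha>, OF assms(2,3)] by simp
  then have limit_value: "lim y = (\<Sum>k<m. partial_coeff \<alpha> k *\<^sub>R y k) /\<^sub>R ?S"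
    using recurrence_limit_eq[OF assms(3,5)] lim by blast
  have expand: "(\<Sum>k<m. partial_coeff \<alpha> k *\<^sub>R y k) /\<^sub>R ?S
      = (\<Sum>k<m. \<Sum>i\<le>k. \<alpha> i *\<^sub>R y k) /\<^sub>R (\<Sum>k<m. \<Sum>i\<le>k. \<alpha> i)"
    by (simp only: partial_coeff_def scaleR_sum_left)
  have weights: "(\<Sum>k<m. partial_coeff \<alpha> k *\<^sub>R y k) /\<^sub>R ?S = (\<Sum>k<m. weight m \<alpha> k *\<^sub>R y k)"
    by (simp add: weight_def scaleR_sum_right divide_inverse mult.commute)
  show ?thesis
    using conv ell limit_value expand weights by simp
qed

end
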